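(* There exists an absolute constant $C>0$ such that the following holds. Let $1\le m\le n$ be integers, let $\mu$ be a Borel measure on $\mathbb{R}^n$ with radially decreasing density $\phi\colon\mathbb{R}^n\to[0,\infty)$, and let $H\subset\mathbb{R}^n$ be an $m$-dimensional linear subspace. Let $s$ be a positive integer and put $$C(n,m,s)=\left[\frac{C(n+s)}{m+s}\right]^{m+s}.$$ Then for any integrable $\left(\frac1s\right)$-concave functions $f,g\colon\mathbb{R}^n\to[0,\infty)$, each of whose supports contains the origin as an interior point, $$\left(\int_{\mathbb{R}^n}\min\{f(x),g(x)\}\,dx\right)\left(\int_H\Delta_{\frac1s}^{f,g}(x)\,d\mu(x)\right)\le C(n,m,s)\left(\int_{\mathbb{R}^n}f(x)\,dx\right)\left(\sup_{y\in\mathbb{R}^n}\int_Hg(y-x)\,d\mu(x)\right).$$ In particular, $$\int_H\Delta_{\frac1s}f(x)\,d\mu(x)\le C(n,m,s)\cdot\sup_{y\in\mathbb{R}^n}\int_Hf(x+y)\,d\mu(x).$$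
   Context: A function $f\colon\mathbb{R}^n\to[0,\infty)$ is $\left(\frac1s\right)$-concave ($s>0$) if $f((1-\lambda)x+\lambda y)\ge((1-\lambda)f(x)^{1/s}+\lambda f(y)^{1/s})^s$ for all $\lambda\in[0,1]$ and all $x,y$ with $f(x)f(y)>0$. For such $f,g$, $$\Delta^{f,g}_{\frac1s}(x)=\sup_{x=x_1-x_2}M_{1/s}(f(x_1),g(x_2)),$$ where $M_{1/s}(a,b)=(a^{1/s}+b^{1/s})^s$ if $ab>0$ and $M_{1/s}(a,b)=0$ if $ab=0$; and $\Delta_{\frac1s}f=\Delta^{f,f}_{\frac1s}$. A function $\phi$ is radially decreasing if $\phi(tx)\ge\phi(x)$ for all $t\in[0,1]$, $x\in\mathbb{R}^n$. If $\mu$ has (Borel) density $\phi$ and $H$ is a linear subspace, then $\int_HF\,d\mu=\int_HF(x)\phi(x)\,dx$ with $dx$ Lebesgue measure on $H$. *)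

theory Defs
  imports "HOL-Analysis.Analysis" "HOL-Library.Function_Algebras"
begin

text \<open>
  The constant in the theorem is independent of the dimension, so the dimension has to be an ordinary
  natural number rather than a type. We realise \<open>\<real>\<^sup>n\<close> as the subspace of the real vector space
  \<open>nat \<Rightarrow> real\<close> consisting of the sequences that vanish from index \<open>n\<close> on. All vector space notions
  (\<^const>\<open>subspace\<close>, \<^const>\<open>span\<close>, \<^const>\<open>dim\<close>) are those of the library. The topology of
  \<open>nat \<Rightarrow> real\<close> is the product topology, which induces the Euclidean one on \<open>\<real>\<^sup>n\<close>.
\<close>

instantiation "fun" :: (type, real_vector) real_vector
begin

definition scaleR_fun :: "real \<Rightarrow> ('a \<Rightarrow> 'b) \<Rightarrow> 'a \<Rightarrow> 'b" where
  "scaleR_fun c f = (\<lambda>x. c *\<^sub>R f x)"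

instance
  by standard (simp_all add: scaleR_fun_def fun_eq_iff scaleR_add_right scaleR_add_left)

end

lemma scaleR_fun_apply [simp]: "(c *\<^sub>R f) x = c *\<^sub>R f x"
  by (simp add: scaleR_fun_def)

definition Rn :: "nat \<Rightarrow> (nat \<Rightarrow> real) set" where
  "Rn n = {x. \<forall>i\<ge>n. x i = 0}"

definition inner_Rn :: "nat \<Rightarrow> (nat \<Rightarrow> real) \<Rightarrow> (nat \<Rightarrow> real) \<Rightarrow> real" where
  "inner_Rn n x y = (\<Sum>i<n. x i * y i)"

definition borel_Rn :: "nat \<Rightarrow> (nat \<Rightarrow> real) measure" where
  "borel_Rn n = restrict_space borel (Rn n)"

definition lebesgue_Rn :: "nat \<Rightarrow> (nat \<Rightarrow> real) measure" where
  "lebesgue_Rn n = completion (distr (\<Pi>\<^sub>M i\<in>{..<n}. lborel) (borel_Rn n)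
     (\<lambda>c i. if i < n then c i else 0))"

definition orthonormal_basis :: "nat \<Rightarrow> nat \<Rightarrow> (nat \<Rightarrow> nat \<Rightarrow> real) \<Rightarrow> (nat \<Rightarrow> real) set \<Rightarrow> bool" where
  "orthonormal_basis n m u H \<longleftrightarrow>
     (\<forall>i<m. \<forall>j<m. inner_Rn n (u i) (u j) = (if i = j then 1 else 0)) \<and> span (u ` {..<m}) = H"

text \<open>
  Lebesgue measure on a linear subspace \<open>H\<close> of \<open>\<real>\<^sup>n\<close>: the image of Lebesgue measure on \<open>\<real>\<^sup>m\<close>,
  \<open>m = dim H\<close>, under the linear isometry onto \<open>H\<close> given by an orthonormal basis of \<open>H\<close>. By rotation
  invariance of Lebesgue measure it does not depend on the basis chosen; that one exists is
  shown below.
\<close>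

definition lebesgue_subspace :: "nat \<Rightarrow> (nat \<Rightarrow> real) set \<Rightarrow> (nat \<Rightarrow> real) measure" where
  "lebesgue_subspace n H =
     (let m = dim H; u = (SOME u. orthonormal_basis n m u H)
      in completion (distr (\<Pi>\<^sub>M i\<in>{..<m}. lborel) (restrict_space borel H)
           (\<lambda>c. \<Sum>i<m. c i *\<^sub>R u i)))"

text \<open>
  \<open>\<integral>\<^sub>H F d\<mu>\<close> for the measure \<open>\<mu>\<close> with density \<open>\<phi>\<close>. As \<open>H\<close> may be a null set of \<open>\<real>\<^sup>n\<close>, this depends
  on the given function \<open>\<phi>\<close> and not only on the measure \<open>\<mu>\<close>.
\<close>

definition subspace_integral ::
  "nat \<Rightarrow> (nat \<Rightarrow> real) set \<Rightarrow> ((nat \<Rightarrow> real) \<Rightarrow> real) \<Rightarrow> ((nat \<Rightarrow> real) \<Rightarrow> ennreal) \<Rightarrow> ennreal" where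
  "subspace_integral n H \<phi> F = (\<integral>\<^sup>+x. F x * ennreal (\<phi> x) \<partial>lebesgue_subspace n H)"

definition radially_decreasing :: "nat \<Rightarrow> ((nat \<Rightarrow> real) \<Rightarrow> real) \<Rightarrow> bool" where
  "radially_decreasing n \<phi> \<longleftrightarrow> (\<forall>x\<in>Rn n. \<forall>t\<in>{0..1}. \<phi> (t *\<^sub>R x) \<ge> \<phi> x)"

text \<open>\<open>root_concave n s f\<close> means that \<open>f\<close> is \<open>(1/s)\<close>-concave on \<open>\<real>\<^sup>n\<close>.\<close>

definition root_concave :: "nat \<Rightarrow> real \<Rightarrow> ((nat \<Rightarrow> real) \<Rightarrow> real) \<Rightarrow> bool" where
  "root_concave n s f \<longleftrightarrow>
     (\<forall>x\<in>Rn n. \<forall>y\<in>Rn n. \<forall>t\<in>{0..1}. f x * f y > 0 \<longrightarrow>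
        f ((1 - t) *\<^sub>R x + t *\<^sub>R y) \<ge> ((1 - t) * f x powr (1 / s) + t * f y powr (1 / s)) powr s)"

definition support_Rn :: "nat \<Rightarrow> ((nat \<Rightarrow> real) \<Rightarrow> real) \<Rightarrow> (nat \<Rightarrow> real) set" where
  "support_Rn n f = closure {x \<in> Rn n. f x \<noteq> 0}"

definition M_root :: "real \<Rightarrow> real \<Rightarrow> real \<Rightarrow> real" where
  "M_root s a b = (if a * b > 0 then (a powr (1 / s) + b powr (1 / s)) powr s else 0)"

definition Delta ::
  "nat \<Rightarrow> real \<Rightarrow> ((nat \<Rightarrow> real) \<Rightarrow> real) \<Rightarrow> ((nat \<Rightarrow> real) \<Rightarrow> real) \<Rightarrow> (nat \<Rightarrow> real) \<Rightarrow> ennreal" where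
  "Delta n s f g x =
     (SUP (x1, x2) \<in> {(x1, x2). x1 \<in> Rn n \<and> x2 \<in> Rn n \<and> x = x1 - x2}. ennreal (M_root s (f x1) (g x2)))"

definition admissible :: "nat \<Rightarrow> real \<Rightarrow> ((nat \<Rightarrow> real) \<Rightarrow> real) \<Rightarrow> bool" where
  "admissible n s f \<longleftrightarrow>
     (\<forall>x\<in>Rn n. 0 \<le> f x) \<and> integrable (lebesgue_Rn n) f \<and> root_concave n s f \<and>
     0 \<in> (top_of_set (Rn n)) interior_of (support_Rn n f)"

definition Const :: "real \<Rightarrow> nat \<Rightarrow> nat \<Rightarrow> nat \<Rightarrow> real" where
  "Const C n m s = (C * real (n + s) / real (m + s)) ^ (m + s)"


lemma inner_Rn_simps:
  "inner_Rn n (x - y) z = inner_Rn n x z - inner_Rn n y z"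
  "inner_Rn n (c *\<^sub>R x) z = c * inner_Rn n x z"
  "inner_Rn n z (c *\<^sub>R x) = c * inner_Rn n z x"
  "inner_Rn n 0 z = 0"
  by (simp_all add: inner_Rn_def sum_subtractf sum_distrib_left algebra_simps)

lemma inner_Rn_sum: "inner_Rn n (\<Sum>i\<in>A. f i) z = (\<Sum>i\<in>A. inner_Rn n (f i) z)"
proof (induction A rule: infinite_finite_induct)
  case (insert a A)
  then show ?case by (simp add: inner_Rn_def sum.distrib algebra_simps)
qed (simp_all add: inner_Rn_def)

lemma inner_Rn_commute: "inner_Rn n x y = inner_Rn n y x"
  by (simp add: inner_Rn_def mult.commute)

lemma inner_Rn_self_pos:
  assumes "x \<in> Rn n" "x \<noteq> 0"
  shows "inner_Rn n x x > 0"
proof -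
  obtain i where i: "x i \<noteq> 0" using assms(2) by (auto simp: fun_eq_iff)
  with assms(1) have "i < n" by (force simp: Rn_def not_le[symmetric])
  then show ?thesis unfolding inner_Rn_def using i
    by (intro sum_pos2[of _ i]) (auto simp: zero_less_mult_iff less_le)
qed

lemma orthonormal_independent:
  fixes k :: nat
  assumes "\<And>i j. i < k \<Longrightarrow> j < k \<Longrightarrow> inner_Rn n (u i) (u j) = (if i = j then 1 else 0)"
  shows "inj_on u {..<k}" "independent (u ` {..<k})"
proof -
  show inj: "inj_on u {..<k}"
  proof (rule inj_onI)
    fix i j assume "i \<in> {..<k}" "j \<in> {..<k}" "u i = u j"
    then show "i = j" using assms[of i j] assms[of i i] by (auto split: if_splits)
  qed
  show "independent (u ` {..<k})"
  proof (rule independent_if_scalars_zero)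
    fix f x assume 0: "(\<Sum>x\<in>u ` {..<k}. f x *\<^sub>R x) = 0" and "x \<in> u ` {..<k}"
    then obtain j where j: "j < k" "x = u j" by auto
    have "0 = inner_Rn n (\<Sum>i<k. f (u i) *\<^sub>R u i) (u j)"
      using 0 by (simp add: sum.reindex[OF inj] inner_Rn_simps)
    also have "\<dots> = (\<Sum>i<k. if i = j then f (u j) else 0)"
      unfolding inner_Rn_sum using assms j by (intro sum.cong) (auto simp: inner_Rn_simps)
    also have "\<dots> = f (u j)" using j by simp
    finally show "f x = 0" using j by simp
  qed simp
qed

lemma orthonormal_extend:
  fixes k :: nat
  assumes on: "\<And>i j. i < k \<Longrightarrow> j < k \<Longrightarrow> inner_Rn n (u i) (u j) = (if i = j then 1 else 0)"
    and H: "subspace H" "H \<subseteq> Rn n" "u ` {..<k} \<subseteq> H" and ne: "span (u ` {..<k}) \<noteq> H"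
  shows "\<exists>w\<in>H. inner_Rn n w w = 1 \<and> (\<forall>i<k. inner_Rn n w (u i) = 0)"
proof -
  have "span (u ` {..<k}) \<subseteq> H" using H by (simp add: span_minimal)
  with ne obtain v where v: "v \<in> H" "v \<notin> span (u ` {..<k})" by auto
  define p where "p = (\<Sum>i<k. inner_Rn n v (u i) *\<^sub>R u i)"
  define w where "w = v - p"
  have p: "p \<in> span (u ` {..<k})"
    unfolding p_def by (intro span_sum span_scale span_base) auto
  have w0: "w \<noteq> 0" using v p by (auto simp: w_def)
  have wH: "w \<in> H" unfolding w_def using v p \<open>span (u ` {..<k}) \<subseteq> H\<close> H by (auto intro: subspace_diff)
  have orth: "inner_Rn n w (u j) = 0" if j: "j < k" for j
  proof -
    have "inner_Rn n p (u j) = (\<Sum>i<k. if i = j then inner_Rn n v (u j) else 0)"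
      unfolding p_def inner_Rn_sum using on j by (intro sum.cong) (auto simp: inner_Rn_simps)
    then show ?thesis using j by (simp add: w_def inner_Rn_simps)
  qed
  define r where "r = inner_Rn n w w"
  have r: "r > 0" unfolding r_def using inner_Rn_self_pos wH w0 H by blast
  have "inner_Rn n ((1 / sqrt r) *\<^sub>R w) ((1 / sqrt r) *\<^sub>R w) = r / (sqrt r * sqrt r)"
    by (simp add: inner_Rn_simps r_def)
  also have "\<dots> = 1" using r by simp
  finally show ?thesis using orth H wH
    by (intro bexI[of _ "(1 / sqrt r) *\<^sub>R w"]) (auto simp: inner_Rn_simps subspace_scale)
qed

lemma Rn_span: "Rn n \<subseteq> span ((\<lambda>i j. if j = i then 1 else 0) ` {..<n})"
proof
  fix x assume x: "x \<in> Rn n"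
  let ?e = "\<lambda>i j. if j = i then 1 else (0::real)"
  have app: "(\<Sum>i\<in>A. x i *\<^sub>R ?e i) j = (\<Sum>i\<in>A. x i * ?e i j)" for A :: "nat set" and j
    by (induction A rule: infinite_finite_induct) auto
  have "x = (\<Sum>i<n. x i *\<^sub>R ?e i)"
    using x by (intro ext) (auto simp: app Rn_def if_distrib cong: if_cong)
  also have "\<dots> \<in> span (?e ` {..<n})"
    by (intro span_sum span_scale span_base) auto
  finally show "x \<in> span (?e ` {..<n})" .
qed

lemma orthonormal_basis_exists:
  assumes H: "subspace H" "H \<subseteq> Rn n"
  shows "\<exists>u. orthonormal_basis n (dim H) u H"
proof -
  let ?on = "\<lambda>k u. \<forall>i<k. \<forall>j<k. inner_Rn n (u i) (u j) = (if i = j then 1 else 0)"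
  obtain B where B: "B \<subseteq> H" "independent B" "H \<subseteq> span B" "card B = dim H"
    by (rule basis_exists)
  have finB: "finite B"
    using independent_span_bound[OF _ B(2)] B(1) H(2) Rn_span[of n] by blast
  have bound: "k \<le> dim H" if "?on k u" "u ` {..<k} \<subseteq> H" for k u
  proof -
    have "inj_on u {..<k}" "independent (u ` {..<k})"
      using orthonormal_independent[of k n u] that(1) by blast+
    then show ?thesis
      using independent_span_bound[OF finB, of "u ` {..<k}"] that(2) B by (auto simp: card_image)
  qed
  have ext: "\<exists>u'. ?on (Suc k) u' \<and> u' ` {..<Suc k} \<subseteq> H"
    if u: "?on k u" "u ` {..<k} \<subseteq> H" and ne: "span (u ` {..<k}) \<noteq> H" for k u
  proof -
    obtain w where w: "w \<in> H" "inner_Rn n w w = 1" "\<forall>i<k. inner_Rn n w (u i) = 0"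
      using orthonormal_extend[of k n u H] u ne H by blast
    then have "\<forall>i<k. inner_Rn n (u i) w = 0" by (simp add: inner_Rn_commute)
    with w u show ?thesis
      by (intro exI[of _ "u(k := w)"]) (auto simp: less_Suc_eq lessThan_Suc image_subset_iff)
  qed
  have "\<exists>u. ?on k u \<and> u ` {..<k} \<subseteq> H" if "k \<le> dim H" for k
    using that
  proof (induction k)
    case (Suc k)
    then obtain u where u: "?on k u" "u ` {..<k} \<subseteq> H" by auto
    have "span (u ` {..<k}) \<noteq> H"
    proof
      assume "span (u ` {..<k}) = H"
      then have "dim H \<le> card (u ` {..<k})"
        using dim_le_card[of H "u ` {..<k}"] by auto
      also have "\<dots> \<le> k" using card_image_le[of "{..<k}" u] by simp
      finally show False using Suc.prems by simp
    qed
    then show ?case using ext u by blast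
  qed auto
  then obtain u where u: "?on (dim H) u" "u ` {..<dim H} \<subseteq> H" by blast
  have "span (u ` {..<dim H}) = H"
    using ext[OF u] bound[of "Suc (dim H)"] by fastforce
  then show ?thesis using u unfolding orthonormal_basis_def by blast
qed

lemma measurable_fun_borelI:
  fixes T :: "'a \<Rightarrow> nat \<Rightarrow> real"
  assumes "\<And>i. (\<lambda>c. T c i) \<in> borel_measurable M" "\<And>c. c \<in> space M \<Longrightarrow> T c \<in> A"
  shows "T \<in> measurable M (restrict_space borel A)"
  using assms by (intro measurable_restrict_space2 measurable_coordinatewise_then_product) auto

lemma measurable_lebesgue_Rn_map:
  "(\<lambda>c i. if i < n then c i else 0) \<in> measurable (\<Pi>\<^sub>M i\<in>{..<n}. lborel) (borel_Rn n)"
  unfolding borel_Rn_def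
proof (rule measurable_fun_borelI)
  fix i show "(\<lambda>c. if i < n then c i else 0) \<in> borel_measurable (\<Pi>\<^sub>M i\<in>{..<n}. lborel)"
    by (cases "i < n") auto
qed (auto simp: Rn_def)

lemma measurable_lebesgue_subspace_map:
  assumes "orthonormal_basis n m u H"
  shows "(\<lambda>c. \<Sum>i<m. c i *\<^sub>R u i) \<in> measurable (\<Pi>\<^sub>M i\<in>{..<m}. lborel) (restrict_space borel H)"
proof (rule measurable_fun_borelI)
  fix j
  have "(\<Sum>i\<in>A. c i *\<^sub>R u i) j = (\<Sum>i\<in>A. c i * u i j)" for A and c :: "nat \<Rightarrow> real"
    by (induction A rule: infinite_finite_induct) auto
  then show "(\<lambda>c. (\<Sum>i<m. c i *\<^sub>R u i) j) \<in> borel_measurable (\<Pi>\<^sub>M i\<in>{..<m}. lborel)"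
    by simp
next
  fix c :: "nat \<Rightarrow> real"
  have "(\<Sum>i<m. c i *\<^sub>R u i) \<in> span (u ` {..<m})"
    by (intro span_sum span_scale span_base) auto
  then show "(\<Sum>i<m. c i *\<^sub>R u i) \<in> H"
    using assms by (simp add: orthonormal_basis_def)
qed

end

theory Submission
  imports Defs
begin

text \<open>
  Bound the integral over \<open>H\<close> of the convolution \<open>G x = \<integral> f z * g (z - x) dz\<close> from both sides. By Tonelli,
  \<open>\<integral>\<^sub>H G d\<mu> \<le> (\<integral> f) * sup\<^sub>y \<integral>\<^sub>H g (y - x) d\<mu>\<close>. Conversely, if \<open>y = x1 - x2\<close> and \<open>0 < t < 1\<close>, then concavity
  along \<open>z = (1 - t) w + t x1\<close> and \<open>z - t y = (1 - t) w + t x2\<close> together with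
  \<open>((1 - t) u + t a) ((1 - t) v + t b) \<ge> t (1 - t) (a + b) min u v\<close> gives
  \<open>G (t y) \<ge> t\<^sup>s (1 - t)\<^bsup>n + s\<^esup> \<Delta> y * \<integral> min f g\<close>. Substituting \<open>x = t y\<close> in \<open>\<integral>\<^sub>H G d\<mu>\<close> costs \<open>t\<^sup>m\<close>, the density only
  increases from \<open>y\<close> to \<open>t y\<close>, and \<open>t = (m + s) / (m + n + 2 s)\<close> yields \<open>C = 2 e\<close>.

  The second inequality is the case \<open>f = g\<close> for the reflected density, after cancelling \<open>\<integral> f > 0\<close>.

  Since \<open>\<Delta>\<close> and the restriction of \<open>g\<close> to a translate of \<open>H\<close> need not be measurable, the integrals are treated
  as lower integrals, and \<open>f\<close> and \<open>g\<close> are replaced by Borel representatives in \<open>G\<close>.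
\<close>

section \<open>Lower integrals of arbitrary functions, and Tonelli's theorem for image
  measures\<close>

lemma nn_integral_cmult_le:
  fixes F :: "'a \<Rightarrow> ennreal"
  shows "c * (\<integral>\<^sup>+x. F x \<partial>M) \<le> (\<integral>\<^sup>+x. c * F x \<partial>M)"
proof -
  \<comment> \<open>The integral of an arbitrary \<open>F\<close> is a supremum over simple
    minorants \<open>g\<close>, and each \<open>c * g\<close> is a measurable minorant of
    \<open>c * F\<close>.\<close>
  have "c * integral\<^sup>S M g \<le> (\<integral>\<^sup>+x. c * F x \<partial>M)" if "simple_function M g" "g \<le> F" for g
  proof -
    have "c * integral\<^sup>S M g = (\<integral>\<^sup>+x. c * g x \<partial>M)"
      using that(1) by (subst nn_integral_eq_simple_integral) auto
    also have "\<dots> \<le> (\<integral>\<^sup>+x. c * F x \<partial>M)"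
      using that(2) by (intro nn_integral_mono mult_left_mono) (auto simp: le_fun_def)
    finally show ?thesis .
  qed
  then show ?thesis
    unfolding nn_integral_def[of M F] SUP_mult_left_ennreal by (intro SUP_least) auto
qed

text \<open>Composing a simple minorant of \<open>F\<close> with \<open>T\<close> gives a minorant
  of the composite. Equality can fail for nonmeasurable \<open>F\<close>, since minorants of the
  composite need not factor through \<open>T\<close>.\<close>

lemma nn_integral_distr_le:
  fixes F :: "'b \<Rightarrow> ennreal"
  assumes T: "T \<in> measurable M N"
  shows "(\<integral>\<^sup>+x. F x \<partial>distr M N T) \<le> (\<integral>\<^sup>+x. F (T x) \<partial>M)"
  unfolding nn_integral_def[of "distr M N T"]
proof (intro SUP_least)
  fix g assume "g \<in> {g. simple_function (distr M N T) g \<and> g \<le> F}"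
  then have g: "simple_function (distr M N T) g" "g \<le> F" by auto
  have "integral\<^sup>S (distr M N T) g = (\<integral>\<^sup>+x. g (T x) \<partial>M)"
    using g(1) by (subst nn_integral_eq_simple_integral[symmetric])
      (auto intro!: nn_integral_distr T borel_measurable_simple_function)
  also have "\<dots> \<le> (\<integral>\<^sup>+x. F (T x) \<partial>M)"
    using g(2) by (intro nn_integral_mono) (auto simp: le_fun_def)
  finally show "integral\<^sup>S (distr M N T) g \<le> (\<integral>\<^sup>+x. F (T x) \<partial>M)" .
qed

text \<open>An image of a sigma-finite measure need not be sigma-finite. Hence both integrals are
  pulled back along \<open>S\<close> and \<open>T\<close>, swapped over \<open>M\<close> and
  \<open>N\<close>, and pushed forward again.\<close>

lemma nn_integral_distr_Fubini:
  assumes MN: "sigma_finite_measure M" "sigma_finite_measure N"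
    and S[measurable]: "S \<in> measurable M M'" and T[measurable]: "T \<in> measurable N N'"
    and h: "(\<lambda>(z, x). h z x) \<in> borel_measurable (M' \<Otimes>\<^sub>M N')"
  shows "(\<integral>\<^sup>+z. \<integral>\<^sup>+x. h z x \<partial>distr N N' T \<partial>distr M M' S) =
      (\<integral>\<^sup>+x. \<integral>\<^sup>+z. h z x \<partial>distr M M' S \<partial>distr N N' T)" (is ?eq)
    and "(\<lambda>z. \<integral>\<^sup>+x. h z x \<partial>distr N N' T) \<in> borel_measurable M'" (is ?z)
    and "(\<lambda>x. \<integral>\<^sup>+z. h z x \<partial>distr M M' S) \<in> borel_measurable N'" (is ?x)
proof -
  interpret M: sigma_finite_measure M by fact
  interpret N: sigma_finite_measure N by fact
  interpret pair_sigma_finite M N by standard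
  note h[measurable]
  have h2[measurable]: "(\<lambda>(x, z). h z x) \<in> borel_measurable (N' \<Otimes>\<^sub>M M')"
    using measurable_pair_swap'[of N' M'] h
    by (subst measurable_pair_swap_iff) (simp add: case_prod_unfold)
  have hz: "(\<integral>\<^sup>+x. h z x \<partial>distr N N' T) = (\<integral>\<^sup>+c. h z (T c) \<partial>N)" if "z \<in> space M'" for z
    using measurable_compose[OF measurable_Pair1' h, OF that] by (intro nn_integral_distr) auto
  have hx: "(\<integral>\<^sup>+z. h z x \<partial>distr M M' S) = (\<integral>\<^sup>+d. h (S d) x \<partial>M)" if "x \<in> space N'" for x
    using measurable_compose[OF measurable_Pair1' h2, OF that] by (intro nn_integral_distr) auto
  have mz[measurable]: "(\<lambda>z. \<integral>\<^sup>+c. h z (T c) \<partial>N) \<in> borel_measurable M'" by measurable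
  have mx[measurable]: "(\<lambda>x. \<integral>\<^sup>+d. h (S d) x \<partial>M) \<in> borel_measurable N'" by measurable
  show ?z using mz by (simp add: hz cong: measurable_cong)
  show ?x using mx by (simp add: hx cong: measurable_cong)
  have "(\<integral>\<^sup>+z. \<integral>\<^sup>+x. h z x \<partial>distr N N' T \<partial>distr M M' S) =
      (\<integral>\<^sup>+z. \<integral>\<^sup>+c. h z (T c) \<partial>N \<partial>distr M M' S)"
    by (intro nn_integral_cong) (simp add: hz)
  also have "\<dots> = (\<integral>\<^sup>+d. \<integral>\<^sup>+c. h (S d) (T c) \<partial>N \<partial>M)"
    by (intro nn_integral_distr) auto
  also have "\<dots> = (\<integral>\<^sup>+c. \<integral>\<^sup>+d. h (S d) (T c) \<partial>M \<partial>N)"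
    by (intro Fubini'[symmetric]) measurable
  also have "\<dots> = (\<integral>\<^sup>+x. \<integral>\<^sup>+d. h (S d) x \<partial>M \<partial>distr N N' T)"
    by (intro nn_integral_distr[symmetric]) auto
  also have "\<dots> = (\<integral>\<^sup>+x. \<integral>\<^sup>+z. h z x \<partial>distr M M' S \<partial>distr N N' T)"
    by (intro nn_integral_cong) (simp add: hx)
  finally show ?eq .
qed

section \<open>Product Lebesgue measure: sigma-finiteness and affine substitution\<close>

lemma sigma_finite_PiM_lborel: "sigma_finite_measure (\<Pi>\<^sub>M i\<in>{..<n::nat}. (lborel :: real measure))"
proof -
  interpret product_sigma_finite "\<lambda>_::nat. lborel :: real measure"
    by standard
  show ?thesis by (rule sigma_finite) simp
qed

text \<open>By \<open>PiM_eqI\<close> it is enough to compare boxes, where each of the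
  \<open>n\<close> factors contributes \<open>|a|\<close>. The restriction to \<open>{..<n}\<close>
  keeps the affine map inside the extensional functions that form the product space.\<close>

lemma PiM_lborel_affine:
  fixes a :: real
  assumes a: "a \<noteq> 0"
  shows "(\<Pi>\<^sub>M i\<in>{..<n::nat}. lborel) = scale_measure (ennreal (\<bar>a\<bar> ^ n))
    (distr (\<Pi>\<^sub>M i\<in>{..<n}. lborel) (\<Pi>\<^sub>M i\<in>{..<n}. lborel) (\<lambda>c. \<lambda>i\<in>{..<n}. b i + a * c i))"
    (is "?P = scale_measure _ (distr _ _ ?A)")
proof -
  interpret product_sigma_finite "\<lambda>_::nat. lborel :: real measure"
    by standard
  have A[measurable]: "?A \<in> measurable ?P ?P" by measurable
  have "scale_measure (ennreal (\<bar>a\<bar> ^ n)) (distr ?P ?P ?A) = ?P"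
  proof (rule PiM_eqI)
    fix X :: "nat \<Rightarrow> real set" assume X: "\<And>i. i \<in> {..<n} \<Longrightarrow> X i \<in> sets lborel"
    have sc: "emeasure lborel Y = ennreal \<bar>a\<bar> * emeasure lborel ((\<lambda>x. t + a * x) -` Y)"
      if "Y \<in> sets borel" for Y and t :: real
      using that by (subst lborel_real_affine[OF a, of t])
        (simp add: emeasure_density nn_integral_cmult_indicator emeasure_distr)
    have vm: "(\<lambda>x. b i + a * x) -` X i \<in> sets borel" if "i < n" for i
      using X[of i] that measurable_sets[of "\<lambda>x. b i + a * x" borel borel "X i"] by simp
    have "?A -` Pi\<^sub>E {..<n} X \<inter> space ?P = (\<Pi>\<^sub>E i\<in>{..<n}. (\<lambda>x. b i + a * x) -` X i)"
      by (auto simp: space_PiM PiE_iff)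
    then have "emeasure (scale_measure (ennreal (\<bar>a\<bar> ^ n)) (distr ?P ?P ?A)) (Pi\<^sub>E {..<n} X) =
      ennreal (\<bar>a\<bar> ^ n) * emeasure ?P (\<Pi>\<^sub>E i\<in>{..<n}. (\<lambda>x. b i + a * x) -` X i)"
      using X by (simp add: emeasure_distr sets_PiM_I_finite)
    also have "\<dots> = ennreal (\<bar>a\<bar> ^ n) * (\<Prod>i<n. emeasure lborel ((\<lambda>x. b i + a * x) -` X i))"
      using vm by (subst emeasure_PiM) auto
    also have "\<dots> = (\<Prod>i<n. ennreal \<bar>a\<bar> * emeasure lborel ((\<lambda>x. b i + a * x) -` X i))"
      by (simp add: prod.distrib ennreal_power)
    also have "\<dots> = (\<Prod>i<n. emeasure lborel (X i))"
      using X sc by (intro prod.cong) auto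
    finally show "emeasure (scale_measure (ennreal (\<bar>a\<bar> ^ n)) (distr ?P ?P ?A)) (Pi\<^sub>E {..<n} X) =
      (\<Prod>i<n. emeasure lborel (X i))" .
  qed auto
  then show ?thesis by simp
qed

lemma nn_integral_PiM_lborel_affine:
  fixes a :: real
  assumes a: "a \<noteq> 0" and h[measurable]: "h \<in> borel_measurable (\<Pi>\<^sub>M i\<in>{..<n::nat}. lborel)"
  shows "(\<integral>\<^sup>+c. h c \<partial>(\<Pi>\<^sub>M i\<in>{..<n}. lborel)) =
    ennreal (\<bar>a\<bar> ^ n) * (\<integral>\<^sup>+c. h (\<lambda>i\<in>{..<n}. b i + a * c i) \<partial>(\<Pi>\<^sub>M i\<in>{..<n}. lborel))"
  by (subst PiM_lborel_affine[OF a, of n b]) (simp add: nn_integral_scale_measure nn_integral_distr)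

subsection \<open>Borel parts of the Lebesgue measures\<close>

text \<open>This is \<open>lebesgue_Rn\<close> before completion. Completion changes no nonnegative
  integral, so the work is done here, where product measurability and substitution are
  available.\<close>

definition lborel_Rn :: "nat \<Rightarrow> (nat \<Rightarrow> real) measure" where
  "lborel_Rn n = distr (\<Pi>\<^sub>M i\<in>{..<n}. lborel) (borel_Rn n) (\<lambda>c i. if i < n then c i else 0)"

lemma lebesgue_Rn_eq: "lebesgue_Rn n = completion (lborel_Rn n)"
  by (simp add: lebesgue_Rn_def lborel_Rn_def)

lemma sets_lborel_Rn [measurable_cong, simp]: "sets (lborel_Rn n) = sets (borel_Rn n)"
  by (simp add: lborel_Rn_def)

lemma space_borel_Rn [simp]: "space (borel_Rn n) = Rn n"
  by (simp add: borel_Rn_def space_restrict_space)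

lemma space_lborel_Rn [simp]: "space (lborel_Rn n) = Rn n"
  by (simp add: lborel_Rn_def)

lemma Rn_closed [simp]:
  "x \<in> Rn n \<Longrightarrow> y \<in> Rn n \<Longrightarrow> x + y \<in> Rn n"
  "x \<in> Rn n \<Longrightarrow> y \<in> Rn n \<Longrightarrow> x - y \<in> Rn n"
  "x \<in> Rn n \<Longrightarrow> c *\<^sub>R x \<in> Rn n"
  "x \<in> Rn n \<Longrightarrow> - x \<in> Rn n"
  "0 \<in> Rn n"
  by (auto simp: Rn_def)

lemma measurable_borel_Rn_coord [measurable]: "(\<lambda>x. x i) \<in> borel_measurable (borel_Rn n)"
  unfolding borel_Rn_def by (intro measurable_restrict_space1) simp

lemma measurable_subspace_coord [measurable]: "(\<lambda>x. x i) \<in> borel_measurable (restrict_space borel (H :: (nat \<Rightarrow> real) set))"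
  by (intro measurable_restrict_space1) simp

lemma measurable_borel_RnI:
  assumes "\<And>i. (\<lambda>c. T c i) \<in> borel_measurable M" "\<And>c. c \<in> space M \<Longrightarrow> T c \<in> Rn n"
  shows "T \<in> measurable M (borel_Rn n)"
  using assms unfolding borel_Rn_def by (rule measurable_fun_borelI)

lemma measurable_affine_borel_Rn:
  assumes "b \<in> Rn n"
  shows "(\<lambda>x. b + a *\<^sub>R x) \<in> measurable (borel_Rn n) (borel_Rn n)"
  by (rule measurable_borel_RnI) (use assms in auto)

lemma nn_integral_lborel_Rn_affine:
  fixes a :: real
  assumes a: "a \<noteq> 0" and b: "b \<in> Rn n" and h: "h \<in> borel_measurable (borel_Rn n)"
  shows "(\<integral>\<^sup>+x. h x \<partial>lborel_Rn n) = ennreal (\<bar>a\<bar> ^ n) * (\<integral>\<^sup>+x. h (b + a *\<^sub>R x) \<partial>lborel_Rn n)"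
proof -
  let ?T = "\<lambda>c i. if i < n then c i else (0::real)"
  note T = measurable_lebesgue_Rn_map[of n]
  \<comment> \<open>The embedding commutes with the affine map because \<open>b\<close> also
    vanishes from index \<open>n\<close> on.\<close>
  have "?T (\<lambda>i\<in>{..<n}. b i + a * c i) = b + a *\<^sub>R ?T c" for c
    using b by (auto simp: fun_eq_iff Rn_def)
  then show ?thesis
    unfolding lborel_Rn_def
    using nn_integral_PiM_lborel_affine[OF a measurable_compose[OF T h], of b]
      measurable_compose[OF measurable_affine_borel_Rn[OF b] h]
    by (simp add: nn_integral_distr T h)
qed

text \<open>Preimages of null sets are null because the substitution factor \<open>|a|^n\<close> is
  positive. This carries an almost-everywhere identity \<open>f = f'\<close> over to the points
  \<open>t x1 + (1 - t) w\<close> for almost every \<open>w\<close>.\<close>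

lemma AE_lborel_Rn_affine:
  fixes a :: real
  assumes a: "a \<noteq> 0" and b: "b \<in> Rn n" and P: "AE x in lborel_Rn n. P x"
  shows "AE x in lborel_Rn n. P (b + a *\<^sub>R x)"
proof -
  obtain N where N: "{x \<in> space (lborel_Rn n). \<not> P x} \<subseteq> N" "emeasure (lborel_Rn n) N = 0"
      "N \<in> sets (lborel_Rn n)"
    using P by (rule AE_E)
  have [measurable]: "N \<in> sets (borel_Rn n)" using N by simp
  note [measurable] = measurable_affine_borel_Rn[OF b]
  have "0 = (\<integral>\<^sup>+x. indicator N x \<partial>lborel_Rn n)" using N by simp
  also have "\<dots> = ennreal (\<bar>a\<bar> ^ n) * (\<integral>\<^sup>+x. indicator N (b + a *\<^sub>R x) \<partial>lborel_Rn n)"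
    by (rule nn_integral_lborel_Rn_affine[OF a b]) simp
  moreover have "\<not> \<bar>a\<bar> ^ n \<le> 0"
    using zero_less_power[of "\<bar>a\<bar>" n] a by linarith
  ultimately have "(\<integral>\<^sup>+x. indicator N (b + a *\<^sub>R x) \<partial>lborel_Rn n) = (0::ennreal)"
    by (simp add: ennreal_eq_0_iff)
  then have "AE x in lborel_Rn n. indicator N (b + a *\<^sub>R x) = (0::ennreal)"
    by (subst (asm) nn_integral_0_iff_AE) auto
  then show ?thesis
    using AE_space
  proof eventually_elim
    case (elim x)
    then have "b + a *\<^sub>R x \<in> Rn n" "b + a *\<^sub>R x \<notin> N"
      using b by (auto simp: indicator_def split: if_splits)
    then show ?case using N(1) by auto
  qed
qed

text \<open>The choice of basis is repeated exactly as in \<open>lebesgue_subspace\<close>, so that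
  the latter is the completion of this measure.\<close>

definition lborel_subspace :: "nat \<Rightarrow> (nat \<Rightarrow> real) set \<Rightarrow> (nat \<Rightarrow> real) measure" where
  "lborel_subspace n H =
     (let m = dim H; u = (SOME u. orthonormal_basis n m u H)
      in distr (\<Pi>\<^sub>M i\<in>{..<m}. lborel) (restrict_space borel H) (\<lambda>c. \<Sum>i<m. c i *\<^sub>R u i))"

lemma lebesgue_subspace_eq: "lebesgue_subspace n H = completion (lborel_subspace n H)"
  by (simp add: lebesgue_subspace_def lborel_subspace_def Let_def)

lemma lborel_subspaceE:
  assumes "subspace H" "H \<subseteq> Rn n"
  obtains u where "orthonormal_basis n (dim H) u H"
    "lborel_subspace n H = distr (\<Pi>\<^sub>M i\<in>{..<dim H}. lborel) (restrict_space borel H)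
       (\<lambda>c. \<Sum>i<dim H. c i *\<^sub>R u i)"
proof (rule that)
  show "orthonormal_basis n (dim H) (SOME u. orthonormal_basis n (dim H) u H) H"
    using orthonormal_basis_exists[OF assms] by (rule someI_ex)
qed (simp add: lborel_subspace_def Let_def)

lemma sets_lborel_subspace [measurable_cong, simp]:
  "sets (lborel_subspace n H) = sets (restrict_space borel H)"
  by (simp add: lborel_subspace_def Let_def)

lemma space_lborel_subspace [simp]: "space (lborel_subspace n H) = H"
  by (simp add: lborel_subspace_def Let_def space_restrict_space)

lemma measurable_scaleR_subspace:
  assumes "subspace H"
  shows "(\<lambda>x. a *\<^sub>R x) \<in> measurable (restrict_space borel H) (restrict_space borel (H :: (nat \<Rightarrow> real) set))"
  by (rule measurable_fun_borelI)
    (use assms in \<open>auto simp: space_restrict_space subspace_scale\<close>)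

text \<open>The coordinate map is linear, so scaling on \<open>H\<close> scales \<open>dim H\<close>
  coordinates. This is where the factor \<open>t^m\<close> of the final substitution comes
  from.\<close>

lemma nn_integral_lborel_subspace_scaleR:
  fixes a :: real
  assumes a: "a \<noteq> 0" and H: "subspace H" "H \<subseteq> Rn n"
    and h: "h \<in> borel_measurable (restrict_space borel H)"
  shows "(\<integral>\<^sup>+x. h x \<partial>lborel_subspace n H) =
    ennreal (\<bar>a\<bar> ^ dim H) * (\<integral>\<^sup>+x. h (a *\<^sub>R x) \<partial>lborel_subspace n H)"
proof -
  obtain u where u: "orthonormal_basis n (dim H) u H"
    "lborel_subspace n H = distr (\<Pi>\<^sub>M i\<in>{..<dim H}. lborel) (restrict_space borel H)
       (\<lambda>c. \<Sum>i<dim H. c i *\<^sub>R u i)"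
    by (rule lborel_subspaceE[OF H])
  note T = measurable_lebesgue_subspace_map[OF u(1)]
  have "(\<Sum>i<dim H. (\<lambda>i\<in>{..<dim H}. 0 + a * c i) i *\<^sub>R u i) = a *\<^sub>R (\<Sum>i<dim H. c i *\<^sub>R u i)"
    for c :: "nat \<Rightarrow> real"
    unfolding scaleR_sum_right by (intro sum.cong) auto
  then show ?thesis
    unfolding u(2)
    using nn_integral_PiM_lborel_affine[OF a measurable_compose[OF T h], of "\<lambda>_. 0"]
      measurable_compose[OF measurable_scaleR_subspace[OF H(1)] h]
    by (simp add: nn_integral_distr T h)
qed

text \<open>For arbitrary \<open>F\<close> the substitution rule for image measures is only an
  inequality. Since reflection preserves the measure and is an involution, applying that inequality
  to \<open>F\<close> and to its reflection gives equality.\<close>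

lemma nn_integral_lborel_subspace_uminus:
  assumes H: "subspace H" "H \<subseteq> Rn n"
  shows "(\<integral>\<^sup>+x. F (- x) \<partial>lborel_subspace n H) = (\<integral>\<^sup>+x. F x \<partial>lborel_subspace n H)"
proof -
  let ?E = "lborel_subspace n H"
  have m: "uminus \<in> measurable ?E ?E"
    using measurable_scaleR_subspace[OF H(1), of "-1"] by (simp cong: measurable_cong_sets)
  have E: "distr ?E ?E uminus = ?E"
  proof (rule measure_eqI)
    fix X assume "X \<in> sets (distr ?E ?E uminus)"
    then have X: "X \<in> sets ?E" by simp
    then have "emeasure (distr ?E ?E uminus) X = (\<integral>\<^sup>+x. indicator X (- x) \<partial>?E)"
      using m by (simp add: nn_integral_distr flip: nn_integral_indicator)
    also have "\<dots> = (\<integral>\<^sup>+x. indicator X x \<partial>?E)"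
      using nn_integral_lborel_subspace_scaleR[of "-1" H n "indicator X"] H X by simp
    finally show "emeasure (distr ?E ?E uminus) X = emeasure ?E X"
      using X by simp
  qed simp
  have le: "(\<integral>\<^sup>+x. F x \<partial>?E) \<le> (\<integral>\<^sup>+x. F (- x) \<partial>?E)" for F
    using nn_integral_distr_le[OF m, of F] by (simp add: E)
  show ?thesis using le[of F] le[of "\<lambda>x. F (- x)"] by simp
qed

subsection \<open>The convolution\<close>

lemma root_concaveD:
  assumes "root_concave n s f" "x \<in> Rn n" "y \<in> Rn n" "f x > 0" "f y > 0" "0 \<le> t" "t \<le> 1"
  shows "((1 - t) * f x powr (1 / s) + t * f y powr (1 / s)) powr s \<le> f ((1 - t) *\<^sub>R x + t *\<^sub>R y)"
  using assms unfolding root_concave_def by simp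

text \<open>In terms of s-th roots the claim is the s-th power of
  \<open>t (1 - t) (a + b) min u v <= X * Y\<close>, where \<open>X\<close> and \<open>Y\<close> are
  the convex combinations that concavity places below the roots of the two values on the
  right.\<close>

lemma root_concave_mult_ge:
  fixes f g :: "(nat \<Rightarrow> real) \<Rightarrow> real"
  assumes s: "1 \<le> s" and t: "0 < t" "t < 1"
    and f: "\<And>x. x \<in> Rn n \<Longrightarrow> 0 \<le> f x" "root_concave n (real s) f"
    and g: "\<And>x. x \<in> Rn n \<Longrightarrow> 0 \<le> g x" "root_concave n (real s) g"
    and x: "x1 \<in> Rn n" "x2 \<in> Rn n" "w \<in> Rn n"
  shows "t ^ s * (1 - t) ^ s * M_root (real s) (f x1) (g x2) * min (f w) (g w)
    \<le> f ((1 - t) *\<^sub>R w + t *\<^sub>R x1) * g ((1 - t) *\<^sub>R w + t *\<^sub>R x2)"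
proof (cases "f x1 * g x2 > 0 \<and> min (f w) (g w) > 0")
  case False
  \<comment> \<open>Concavity gives nothing where a value vanishes, but then \<open>M_root\<close>
    takes its default value 0 or the minimum is 0.\<close>
  have "M_root (real s) (f x1) (g x2) * min (f w) (g w) = 0"
    using False f(1)[OF x(3)] g(1)[OF x(3)] by (auto simp: M_root_def min_def split: if_splits)
  then have "t ^ s * (1 - t) ^ s * M_root (real s) (f x1) (g x2) * min (f w) (g w) = 0"
    by (simp only: mult.assoc mult_zero_right)
  also have "0 \<le> f ((1 - t) *\<^sub>R w + t *\<^sub>R x1) * g ((1 - t) *\<^sub>R w + t *\<^sub>R x2)"
    using f(1) g(1) x by (intro mult_nonneg_nonneg) auto
  finally show ?thesis .
next
  case True
  then have pos: "f x1 > 0" "g x2 > 0" "f w > 0" "g w > 0"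
    using f(1)[OF x(1)] g(1)[OF x(2)] by (auto simp: zero_less_mult_iff)
  define a b u v where "a = f x1 powr (1 / s)" "b = g x2 powr (1 / s)"
    "u = f w powr (1 / s)" "v = g w powr (1 / s)"
  note defs = this
  have p: "a > 0" "b > 0" "u > 0" "v > 0" using pos by (auto simp: defs)
  have pows: "u ^ s = f w" "v ^ s = g w"
    using pos s by (simp_all add: defs powr_realpow[symmetric] powr_powr)
  have Z: "min (f w) (g w) = min u v ^ s"
    using p pows power_mono[of u v s] power_mono[of v u s] by (auto simp: min_def)
  have M: "M_root (real s) (f x1) (g x2) = (a + b) ^ s"
    using True powr_realpow[OF add_pos_pos[OF p(1,2)], of s] by (simp add: M_root_def defs)
  define X where "X = (1 - t) * u + t * a"
  define Y where "Y = (1 - t) * v + t * b"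
  have XY: "X > 0" "Y > 0" using p t by (auto simp: X_def Y_def intro!: add_pos_pos)
  have fX: "X ^ s \<le> f ((1 - t) *\<^sub>R w + t *\<^sub>R x1)"
    unfolding powr_realpow[OF XY(1), symmetric] unfolding X_def defs
    by (rule root_concaveD[OF f(2) x(3,1) pos(3,1)]) (use t in auto)
  have gY: "Y ^ s \<le> g ((1 - t) *\<^sub>R w + t *\<^sub>R x2)"
    unfolding powr_realpow[OF XY(2), symmetric] unfolding Y_def defs
    by (rule root_concaveD[OF g(2) x(3,2) pos(4,2)]) (use t in auto)
  \<comment> \<open>Only the mixed terms \<open>a * v\<close> and \<open>b * u\<close> of
    \<open>X * Y\<close> are kept; the other two are nonnegative.\<close>
  have "t * (1 - t) * (a + b) * min u v = t * (1 - t) * (a * min u v + b * min u v)"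
    by (simp add: algebra_simps)
  also have "\<dots> \<le> t * (1 - t) * (a * v + b * u)"
    using t p by (intro mult_left_mono add_mono) auto
  also have "\<dots> \<le> t * (1 - t) * (a * v + b * u) + ((1 - t)\<^sup>2 * (u * v) + t\<^sup>2 * (a * b))"
    using t p by auto
  also have "\<dots> = X * Y"
    by (simp add: X_def Y_def power2_eq_square algebra_simps)
  finally have "(t * (1 - t) * (a + b) * min u v) ^ s \<le> (X * Y) ^ s"
    using t p by (intro power_mono) auto
  also have "\<dots> = X ^ s * Y ^ s" by (rule power_mult_distrib)
  also have "\<dots> \<le> f ((1 - t) *\<^sub>R w + t *\<^sub>R x1) * g ((1 - t) *\<^sub>R w + t *\<^sub>R x2)"
    using fX gY XY f(1) x by (intro mult_mono) auto
  finally show ?thesis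
    unfolding M Z by (simp add: power_mult_distrib)
qed

text \<open>One pair with \<open>y = x1 - x2\<close> is treated at a time, and the supremum is taken
  last. The substitution \<open>z = t x1 + (1 - t) w\<close> supplies the extra factor
  \<open>(1 - t)^n\<close>. The convolution uses Borel representatives so that Tonelli applies to it
  later.\<close>

lemma convolution_ge_Delta:
  fixes f g :: "(nat \<Rightarrow> real) \<Rightarrow> real" and f' g' :: "(nat \<Rightarrow> real) \<Rightarrow> ennreal"
  assumes s: "1 \<le> s" and t: "0 < t" "t < 1"
    and f: "\<And>x. x \<in> Rn n \<Longrightarrow> 0 \<le> f x" "root_concave n (real s) f"
    and g: "\<And>x. x \<in> Rn n \<Longrightarrow> 0 \<le> g x" "root_concave n (real s) g"
    and f': "f' \<in> borel_measurable (borel_Rn n)" "AE x in lborel_Rn n. ennreal (f x) = f' x"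
    and g': "g' \<in> borel_measurable (borel_Rn n)" "AE x in lborel_Rn n. ennreal (g x) = g' x"
  shows "ennreal (t ^ s * (1 - t) ^ (n + s)) *
      (\<integral>\<^sup>+x. ennreal (min (f x) (g x)) \<partial>lborel_Rn n) * Delta n (real s) f g y
    \<le> (\<integral>\<^sup>+z. f' z * g' (z - t *\<^sub>R y) \<partial>lborel_Rn n)"
proof -
  let ?I = "\<integral>\<^sup>+x. ennreal (min (f x) (g x)) \<partial>lborel_Rn n"
  have "ennreal (t ^ s * (1 - t) ^ (n + s)) * ?I * ennreal (M_root (real s) (f x1) (g x2))
      \<le> (\<integral>\<^sup>+z. f' z * g' (z - t *\<^sub>R y) \<partial>lborel_Rn n)"
    if x: "x1 \<in> Rn n" "x2 \<in> Rn n" "y = x1 - x2" for x1 x2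
  proof -
    let ?M = "M_root (real s) (f x1) (g x2)"
    have M: "?M \<ge> 0" by (simp add: M_root_def)
    have b: "t *\<^sub>R x1 \<in> Rn n" "t *\<^sub>R x2 \<in> Rn n" "- (t *\<^sub>R y) \<in> Rn n" using x by auto
    have m[measurable]: "(\<lambda>z. f' z * g' (z - t *\<^sub>R y)) \<in> borel_measurable (borel_Rn n)"
      using f'(1) measurable_compose[OF measurable_affine_borel_Rn[OF b(3), of 1] g'(1)]
      by (intro borel_measurable_times_ennreal) simp_all
    have eq: "t *\<^sub>R x1 + (1 - t) *\<^sub>R w - t *\<^sub>R y = t *\<^sub>R x2 + (1 - t) *\<^sub>R w" for w
      unfolding x(3) by (simp add: algebra_simps)
    \<comment> \<open>Both maps of \<open>w\<close> are affine with nonzero factor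
      \<open>1 - t\<close>, so for almost every \<open>w\<close> the representatives agree with
      \<open>f\<close> and \<open>g\<close> at these points.\<close>
    have "AE w in lborel_Rn n. ennreal (f (t *\<^sub>R x1 + (1 - t) *\<^sub>R w)) = f' (t *\<^sub>R x1 + (1 - t) *\<^sub>R w)"
      "AE w in lborel_Rn n. ennreal (g (t *\<^sub>R x2 + (1 - t) *\<^sub>R w)) = g' (t *\<^sub>R x2 + (1 - t) *\<^sub>R w)"
      using t by (intro AE_lborel_Rn_affine b f'(2) g'(2); simp)+
    then have le: "AE w in lborel_Rn n. ennreal (t ^ s * (1 - t) ^ s * ?M) * ennreal (min (f w) (g w))
        \<le> f' (t *\<^sub>R x1 + (1 - t) *\<^sub>R w) * g' (t *\<^sub>R x2 + (1 - t) *\<^sub>R w)"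
      using AE_space
    proof eventually_elim
      case (elim w)
      have w: "w \<in> Rn n" using elim by simp
      have "ennreal (t ^ s * (1 - t) ^ s * ?M) * ennreal (min (f w) (g w))
          = ennreal (t ^ s * (1 - t) ^ s * ?M * min (f w) (g w))"
        using t M by (intro ennreal_mult'[symmetric]) auto
      also have "\<dots> \<le> ennreal (f (t *\<^sub>R x1 + (1 - t) *\<^sub>R w) * g (t *\<^sub>R x2 + (1 - t) *\<^sub>R w))"
        using root_concave_mult_ge[OF s t f g x(1,2) w] by (intro ennreal_leI) (simp add: add.commute)
      also have "\<dots> = ennreal (f (t *\<^sub>R x1 + (1 - t) *\<^sub>R w)) * ennreal (g (t *\<^sub>R x2 + (1 - t) *\<^sub>R w))"
        using x(1) w f(1) by (intro ennreal_mult') auto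
      finally show ?case using elim by simp
    qed
    have "ennreal (t ^ s * (1 - t) ^ (n + s)) * ?I * ennreal ?M =
        ennreal ((1 - t) ^ n) * (ennreal (t ^ s * (1 - t) ^ s * ?M) * ?I)"
      using t M by (simp add: power_add ennreal_mult' mult_ac)
    \<comment> \<open>The minimum of \<open>f\<close> and \<open>g\<close> need not be Borel, so the
      constant moves inside by an inequality.\<close>
    also have "\<dots> \<le> ennreal ((1 - t) ^ n) *
        (\<integral>\<^sup>+w. ennreal (t ^ s * (1 - t) ^ s * ?M) * ennreal (min (f w) (g w)) \<partial>lborel_Rn n)"
      by (intro mult_left_mono nn_integral_cmult_le) simp
    also have "\<dots> \<le> ennreal ((1 - t) ^ n) *
        (\<integral>\<^sup>+w. f' (t *\<^sub>R x1 + (1 - t) *\<^sub>R w) * g' (t *\<^sub>R x2 + (1 - t) *\<^sub>R w) \<partial>lborel_Rn n)"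
      by (intro mult_left_mono nn_integral_mono_AE le) simp
    also have "\<dots> = (\<integral>\<^sup>+z. f' z * g' (z - t *\<^sub>R y) \<partial>lborel_Rn n)"
      using nn_integral_lborel_Rn_affine[OF _ b(1) m, of "1 - t"] t by (simp add: eq)
    finally show ?thesis .
  qed
  then show ?thesis
    unfolding Delta_def SUP_mult_left_ennreal by (intro SUP_least) auto
qed

text \<open>After swapping the integrals, the inner one over \<open>H\<close> at a fixed
  \<open>z\<close> should be a competitor in the supremum. A single translate of \<open>H\<close>
  may lie in the null set where \<open>g\<close> and \<open>g'\<close> differ, but by Tonelli almost
  every translate meets it in a null set. The second conclusion is what the later substitution on
  \<open>H\<close> requires.\<close>

lemma convolution_le_SUP:
  fixes g :: "(nat \<Rightarrow> real) \<Rightarrow> ennreal" and f' g' :: "(nat \<Rightarrow> real) \<Rightarrow> ennreal"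
  assumes H: "subspace H" "H \<subseteq> Rn n"
    and \<phi>: "\<phi> \<in> borel_measurable (borel_Rn n)"
    and f': "f' \<in> borel_measurable (borel_Rn n)"
    and g': "g' \<in> borel_measurable (borel_Rn n)" "AE x in lborel_Rn n. g x = g' x"
  shows "(\<integral>\<^sup>+x. (\<integral>\<^sup>+z. f' z * g' (z - x) \<partial>lborel_Rn n) * \<phi> x \<partial>lborel_subspace n H)
      \<le> (\<integral>\<^sup>+z. f' z \<partial>lborel_Rn n) * (SUP y\<in>Rn n. \<integral>\<^sup>+x. g (y - x) * \<phi> x \<partial>lborel_subspace n H)"
    and "(\<lambda>x. (\<integral>\<^sup>+z. f' z * g' (z - x) \<partial>lborel_Rn n) * \<phi> x)
      \<in> borel_measurable (restrict_space borel H)"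
proof -
  let ?R = "restrict_space borel H :: (nat \<Rightarrow> real) measure"
  let ?S = "SUP y\<in>Rn n. \<integral>\<^sup>+x. g (y - x) * \<phi> x \<partial>lborel_subspace n H"
  obtain u where u: "orthonormal_basis n (dim H) u H"
    "lborel_subspace n H = distr (\<Pi>\<^sub>M i\<in>{..<dim H}. lborel) (restrict_space borel H)
       (\<lambda>c. \<Sum>i<dim H. c i *\<^sub>R u i)"
    by (rule lborel_subspaceE[OF H])
  note Fub = nn_integral_distr_Fubini[OF sigma_finite_PiM_lborel[of n] sigma_finite_PiM_lborel[of "dim H"]
    measurable_lebesgue_Rn_map measurable_lebesgue_subspace_map[OF u(1)], folded lborel_Rn_def u(2)]
  have \<phi>H[measurable]: "\<phi> \<in> borel_measurable ?R"
    using \<phi> H(2) unfolding borel_Rn_def by (rule measurable_restrict_mono)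
  have diff[measurable]: "(\<lambda>(z, x). z - x) \<in> measurable (borel_Rn n \<Otimes>\<^sub>M ?R) (borel_Rn n)"
    unfolding case_prod_unfold
    by (rule measurable_borel_RnI) (use H in \<open>auto simp: space_pair_measure space_restrict_space\<close>)
  note [measurable] = f' g'(1)
  have gm[measurable]: "(\<lambda>(z, x). g' (z - x)) \<in> borel_measurable (borel_Rn n \<Otimes>\<^sub>M ?R)"
    using measurable_compose[OF diff g'(1)] by (simp add: case_prod_unfold)
  have hm: "(\<lambda>(z, x). f' z * g' (z - x) * \<phi> x) \<in> borel_measurable (borel_Rn n \<Otimes>\<^sub>M ?R)"
    by measurable
  have hm0: "(\<lambda>(z, x). f' z * g' (z - x)) \<in> borel_measurable (borel_Rn n \<Otimes>\<^sub>M ?R)"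
    by measurable
  show "(\<lambda>x. (\<integral>\<^sup>+z. f' z * g' (z - x) \<partial>lborel_Rn n) * \<phi> x) \<in> borel_measurable ?R"
    using Fub(3)[OF hm0] by measurable

  obtain N where N: "{x \<in> space (lborel_Rn n). \<not> g x = g' x} \<subseteq> N" "emeasure (lborel_Rn n) N = 0"
      "N \<in> sets (lborel_Rn n)"
    using g'(2) by (rule AE_E)
  have [measurable]: "N \<in> sets (borel_Rn n)" using N by simp
  have im: "(\<lambda>(z, x). indicator N (z - x) :: ennreal) \<in> borel_measurable (borel_Rn n \<Otimes>\<^sub>M ?R)"
    using measurable_compose[OF diff, of "indicator N :: _ \<Rightarrow> ennreal" borel] by (simp add: case_prod_unfold)
  have "(\<integral>\<^sup>+z. \<integral>\<^sup>+x. indicator N (z - x) \<partial>lborel_subspace n H \<partial>lborel_Rn n) =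
      (\<integral>\<^sup>+x. \<integral>\<^sup>+z. indicator N (z - x) \<partial>lborel_Rn n \<partial>lborel_subspace n H)"
    by (rule Fub(1)[OF im])
  \<comment> \<open>For fixed \<open>x\<close>, the inner integral is the measure of a translate of
    \<open>N\<close>.\<close>
  also have "\<dots> = (\<integral>\<^sup>+x. 0 \<partial>lborel_subspace n H)"
  proof (intro nn_integral_cong)
    fix x assume "x \<in> space (lborel_subspace n H)"
    then have "- x \<in> Rn n" using H by auto
    from nn_integral_lborel_Rn_affine[OF _ this, of 1 "indicator N"] N
    show "(\<integral>\<^sup>+z. indicator N (z - x) \<partial>lborel_Rn n) = (0 :: ennreal)" by simp
  qed
  finally have "(\<integral>\<^sup>+z. \<integral>\<^sup>+x. indicator N (z - x) \<partial>lborel_subspace n H \<partial>lborel_Rn n) = (0 :: ennreal)"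
    by simp
  then have "AE z in lborel_Rn n. (\<integral>\<^sup>+x. indicator N (z - x) \<partial>lborel_subspace n H) = (0 :: ennreal)"
    using Fub(2)[OF im] by (subst (asm) nn_integral_0_iff_AE) (simp_all cong: measurable_cong_sets)
  then have le: "AE z in lborel_Rn n. (\<integral>\<^sup>+x. g' (z - x) * \<phi> x \<partial>lborel_subspace n H) \<le> ?S"
    using AE_space
  proof eventually_elim
    case (elim z)
    have z: "z \<in> Rn n" using elim by simp
    have mz: "(\<lambda>x. indicator N (z - x) :: ennreal) \<in> borel_measurable (lborel_subspace n H)"
      using measurable_compose[OF measurable_Pair1' im, of z] z by (simp cong: measurable_cong_sets)
    have "AE x in lborel_subspace n H. indicator N (z - x) = (0 :: ennreal)"
      using elim(1) mz by (subst (asm) nn_integral_0_iff_AE) auto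
    then have "AE x in lborel_subspace n H. g' (z - x) * \<phi> x = g (z - x) * \<phi> x"
      using AE_space
    proof eventually_elim
      case (elim x)
      then have "z - x \<in> Rn n" "z - x \<notin> N" using z H by (auto simp: indicator_def split: if_splits)
      then show ?case using N by auto
    qed
    then have "(\<integral>\<^sup>+x. g' (z - x) * \<phi> x \<partial>lborel_subspace n H) =
        (\<integral>\<^sup>+x. g (z - x) * \<phi> x \<partial>lborel_subspace n H)"
      by (rule nn_integral_cong_AE)
    \<comment> \<open>With the original \<open>g\<close> restored, the integral is the competitor
      \<open>y = z\<close>.\<close>
    also have "\<dots> \<le> ?S" using z by (rule SUP_upper)
    finally show ?case .
  qed

  have "(\<integral>\<^sup>+x. (\<integral>\<^sup>+z. f' z * g' (z - x) \<partial>lborel_Rn n) * \<phi> x \<partial>lborel_subspace n H) =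
      (\<integral>\<^sup>+x. \<integral>\<^sup>+z. f' z * g' (z - x) * \<phi> x \<partial>lborel_Rn n \<partial>lborel_subspace n H)"
  proof (intro nn_integral_cong)
    fix x assume "x \<in> space (lborel_subspace n H)"
    then have x: "- x \<in> Rn n" using H by auto
    have "(\<lambda>z. f' z * g' (z - x)) \<in> borel_measurable (borel_Rn n)"
      using f' measurable_compose[OF measurable_affine_borel_Rn[OF x, of 1] g'(1)]
      by (intro borel_measurable_times_ennreal) simp_all
    then show "(\<integral>\<^sup>+z. f' z * g' (z - x) \<partial>lborel_Rn n) * \<phi> x =
        (\<integral>\<^sup>+z. f' z * g' (z - x) * \<phi> x \<partial>lborel_Rn n)"
      by (intro nn_integral_multc[symmetric]) (simp cong: measurable_cong_sets)
  qed
  also have "\<dots> = (\<integral>\<^sup>+z. \<integral>\<^sup>+x. f' z * g' (z - x) * \<phi> x \<partial>lborel_subspace n H \<partial>lborel_Rn n)"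
    by (rule Fub(1)[OF hm, symmetric])
  also have "\<dots> = (\<integral>\<^sup>+z. f' z * (\<integral>\<^sup>+x. g' (z - x) * \<phi> x \<partial>lborel_subspace n H) \<partial>lborel_Rn n)"
  proof (intro nn_integral_cong)
    fix z assume "z \<in> space (lborel_Rn n)"
    then have z: "z \<in> space (borel_Rn n)" by simp
    have "(\<lambda>x. g' (z - x) * \<phi> x) \<in> borel_measurable (lborel_subspace n H)"
      using measurable_compose[OF measurable_Pair1' gm, OF z] by (simp cong: measurable_cong_sets)
    then show "(\<integral>\<^sup>+x. f' z * g' (z - x) * \<phi> x \<partial>lborel_subspace n H) =
        f' z * (\<integral>\<^sup>+x. g' (z - x) * \<phi> x \<partial>lborel_subspace n H)"
      by (simp add: mult.assoc nn_integral_cmult)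
  qed
  also have "\<dots> \<le> (\<integral>\<^sup>+z. f' z * ?S \<partial>lborel_Rn n)"
    using le by (intro nn_integral_mono_AE) (auto elim!: eventually_mono intro: mult_left_mono)
  also have "\<dots> = (\<integral>\<^sup>+z. f' z \<partial>lborel_Rn n) * ?S"
    using f' by (intro nn_integral_multc) (simp cong: measurable_cong_sets)
  finally show "(\<integral>\<^sup>+x. (\<integral>\<^sup>+z. f' z * g' (z - x) \<partial>lborel_Rn n) * \<phi> x \<partial>lborel_subspace n H)
      \<le> (\<integral>\<^sup>+z. f' z \<partial>lborel_Rn n) * ?S" .
qed

text \<open>The number \<open>t\<close> maximises \<open>t^p (1 - t)^q\<close> on the unit interval.
  The two factors are estimated separately: \<open>(1 - t)^(-q) = (1 + p/q)^q <= e^p\<close>, while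
  \<open>p <= q\<close> gives \<open>1/t = (p + q)/p <= 2 q/p\<close>.\<close>

lemma inverse_weight_le_Const:
  fixes p q :: nat
  assumes "1 \<le> p" "p \<le> q"
  defines "t \<equiv> real p / real (p + q)"
  shows "1 \<le> (2 * exp 1 * real q / real p) ^ p * (t ^ p * (1 - t) ^ q)"
proof -
  have pos: "real p > 0" "real q > 0" using assms by auto
  have t: "0 < t" "t < 1" "1 - t = real q / real (p + q)"
    using pos by (auto simp: t_def field_simps)
  have "1 / (1 - t) = 1 + real p / real q" using pos by (simp add: t(3) field_simps)
  then have "(1 / (1 - t)) ^ q \<le> exp (real p / real q) ^ q"
    using exp_ge_add_one_self[of "real p / real q"] t by (intro power_mono) auto
  also have "\<dots> = exp 1 ^ p"
    using pos by (simp flip: exp_of_nat_mult)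
  finally have "(1 / (1 - t)) ^ q * (1 - t) ^ q \<le> exp 1 ^ p * (1 - t) ^ q"
    using t by (intro mult_right_mono) auto
  then have 1: "1 \<le> exp 1 ^ p * (1 - t) ^ q"
    using t(1,2) by (simp flip: power_mult_distrib)
  have "2 * real q / real p * t = 2 * real q / real (p + q)"
    using pos by (simp add: t_def)
  then have "1 \<le> 2 * real q / real p * t"
    using pos assms by simp
  then have 2: "1 \<le> (2 * real q / real p * t) ^ p" by (rule one_le_power)
  have "1 * 1 \<le> (2 * real q / real p * t) ^ p * (exp 1 ^ p * (1 - t) ^ q)"
    using 1 2 by (intro mult_mono) auto
  also have "\<dots> = (2 * exp 1 * real q / real p) ^ p * (t ^ p * (1 - t) ^ q)"
    by (simp add: power_mult_distrib power_divide)
  finally show ?thesis by simp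
qed

section \<open>Assembling the general inequality\<close>

lemma admissible_borel_representative:
  assumes "admissible n s f"
  obtains f' where "f' \<in> borel_measurable (borel_Rn n)" "AE x in lborel_Rn n. ennreal (f x) = f' x"
proof -
  have "(\<lambda>x. ennreal (f x)) \<in> borel_measurable (completion (lborel_Rn n))"
    using assms unfolding admissible_def lebesgue_Rn_eq by (auto dest: borel_measurable_integrable)
  from completion_ex_borel_measurable[OF this] show ?thesis
    using that by (auto cong: measurable_cong_sets)
qed

lemma subspace_integral_eq:
  "subspace_integral n H \<phi> F = (\<integral>\<^sup>+x. F x * ennreal (\<phi> x) \<partial>lborel_subspace n H)"
  by (simp add: subspace_integral_def lebesgue_subspace_eq nn_integral_completion)

proposition difference_inequality:
  assumes m: "1 \<le> m" "m \<le> n" "1 \<le> s"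
    and \<phi>: "\<phi> \<in> borel_measurable (borel_Rn n)" "radially_decreasing n \<phi>"
    and H: "subspace H" "H \<subseteq> Rn n" "dim H = m"
    and f: "admissible n s f" and g: "admissible n s g"
  shows "(\<integral>\<^sup>+x. ennreal (min (f x) (g x)) \<partial>lebesgue_Rn n) * subspace_integral n H \<phi> (Delta n s f g)
       \<le> ennreal (Const (2 * exp 1) n m s) * (\<integral>\<^sup>+x. ennreal (f x) \<partial>lebesgue_Rn n) *
         (SUP y\<in>Rn n. subspace_integral n H \<phi> (\<lambda>x. ennreal (g (y - x))))"
proof -
  define t where "t = real (m + s) / real ((m + s) + (n + s))"
  have t: "0 < t" "t < 1" using m by (auto simp: t_def field_simps)
  obtain f' where f': "f' \<in> borel_measurable (borel_Rn n)" "AE x in lborel_Rn n. ennreal (f x) = f' x"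
    using admissible_borel_representative[OF f] .
  obtain g' where g': "g' \<in> borel_measurable (borel_Rn n)" "AE x in lborel_Rn n. ennreal (g x) = g' x"
    using admissible_borel_representative[OF g] .
  have f_ass: "\<And>x. x \<in> Rn n \<Longrightarrow> 0 \<le> f x" "root_concave n (real s) f"
    and g_ass: "\<And>x. x \<in> Rn n \<Longrightarrow> 0 \<le> g x" "root_concave n (real s) g"
    using f g by (auto simp: admissible_def)
  let ?E = "lborel_subspace n H"
  let ?I = "\<integral>\<^sup>+x. ennreal (min (f x) (g x)) \<partial>lborel_Rn n"
  let ?D = "\<integral>\<^sup>+x. Delta n s f g x * ennreal (\<phi> x) \<partial>?E"
  let ?S = "SUP y\<in>Rn n. \<integral>\<^sup>+x. ennreal (g (y - x)) * ennreal (\<phi> x) \<partial>?E"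
  let ?k = "t ^ s * (1 - t) ^ (n + s)"
  define G where "G = (\<lambda>x. (\<integral>\<^sup>+z. f' z * g' (z - x) \<partial>lborel_Rn n) * ennreal (\<phi> x))"
  have \<phi>': "(\<lambda>x. ennreal (\<phi> x)) \<in> borel_measurable (borel_Rn n)" using \<phi> by simp
  note up = convolution_le_SUP[OF H(1,2) \<phi>' f'(1) g', folded G_def]
  \<comment> \<open>The factor \<open>t^m\<close> is set aside for the substitution on
    \<open>H\<close>; the rest is the weight in the lower bound for the convolution.\<close>
  have "ennreal (t ^ (m + s) * (1 - t) ^ (n + s)) * ?I * ?D =
      ennreal (t ^ m) * (ennreal ?k * ?I * ?D)"
    using t by (simp add: power_add ennreal_mult' mult_ac)
  also have "\<dots> \<le> ennreal (t ^ m) *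
      (\<integral>\<^sup>+x. ennreal ?k * ?I * (Delta n s f g x * ennreal (\<phi> x)) \<partial>?E)"
    by (intro mult_left_mono nn_integral_cmult_le) simp
  also have "\<dots> \<le> ennreal (t ^ m) * (\<integral>\<^sup>+x. G (t *\<^sub>R x) \<partial>?E)"
  proof (intro mult_left_mono nn_integral_mono)
    fix x assume "x \<in> space ?E"
    then have x: "x \<in> Rn n" using H by auto
    have "ennreal ?k * ?I * (Delta n s f g x * ennreal (\<phi> x)) =
        ennreal ?k * ?I * Delta n s f g x * ennreal (\<phi> x)" by (simp add: mult.assoc)
    \<comment> \<open>Radial decrease gives \<open>\<phi> x <= \<phi> (t x)\<close>, so the
      convolution and the density are both evaluated at \<open>t x\<close>.\<close>
    also have "\<dots> \<le> G (t *\<^sub>R x)"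
      unfolding G_def using \<phi>(2) x t
      by (intro mult_mono convolution_ge_Delta[OF m(3) t f_ass g_ass f' g'] ennreal_leI)
        (auto simp: radially_decreasing_def)
    finally show "ennreal ?k * ?I * (Delta n s f g x * ennreal (\<phi> x)) \<le> G (t *\<^sub>R x)" .
  qed simp
  also have "\<dots> = (\<integral>\<^sup>+x. G x \<partial>?E)"
    using nn_integral_lborel_subspace_scaleR[OF _ H(1,2) up(2), of t] t H(3) by simp
  also have "\<dots> \<le> (\<integral>\<^sup>+z. f' z \<partial>lborel_Rn n) * ?S" by (rule up(1))
  also have "(\<integral>\<^sup>+z. f' z \<partial>lborel_Rn n) = (\<integral>\<^sup>+z. ennreal (f z) \<partial>lborel_Rn n)"
    using f'(2) by (intro nn_integral_cong_AE) (auto elim: eventually_mono)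
  finally have le: "ennreal (t ^ (m + s) * (1 - t) ^ (n + s)) * ?I * ?D
      \<le> (\<integral>\<^sup>+z. ennreal (f z) \<partial>lborel_Rn n) * ?S" .
  let ?C = "Const (2 * exp 1) n m s"
  \<comment> \<open>The weight is removed by multiplying with \<open>Const\<close>, which avoids
    division in \<open>ennreal\<close>.\<close>
  have "1 \<le> ?C * (t ^ (m + s) * (1 - t) ^ (n + s))"
    using inverse_weight_le_Const[of "m + s" "n + s"] m by (simp add: t_def Const_def)
  then have "1 \<le> ennreal ?C * ennreal (t ^ (m + s) * (1 - t) ^ (n + s))"
    using t by (subst ennreal_mult''[symmetric]) (auto simp del: ennreal_1 simp flip: ennreal_1 intro!: ennreal_leI)
  then have "1 * (?I * ?D) \<le> ennreal ?C * ennreal (t ^ (m + s) * (1 - t) ^ (n + s)) * (?I * ?D)"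
    by (intro mult_right_mono) auto
  also have "\<dots> = ennreal ?C * (ennreal (t ^ (m + s) * (1 - t) ^ (n + s)) * ?I * ?D)"
    by (simp add: mult.assoc)
  also have "\<dots> \<le> ennreal ?C * ((\<integral>\<^sup>+z. ennreal (f z) \<partial>lborel_Rn n) * ?S)"
    using le by (intro mult_left_mono) auto
  finally show ?thesis
    by (simp add: subspace_integral_eq lebesgue_Rn_eq nn_integral_completion mult.assoc)
qed

subsection \<open>Positivity of the integral\<close>

text \<open>Convex combinations make the coordinates agree with those of \<open>x\<close> one at a time.\<close>

lemma convex_meets_orthants:
  assumes A: "convex A" "A \<subseteq> Rn n" and x: "x \<in> Rn n"
    and meets: "\<And>\<sigma> :: nat \<Rightarrow> real. (\<And>i. i < n \<Longrightarrow> \<sigma> i \<noteq> 0) \<Longrightarrow> \<exists>a\<in>A. \<forall>i<n. \<sigma> i * (a i - x i) > 0"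
  shows "x \<in> A"
proof -
  \<comment> \<open>The sign pattern is generalised because the induction step uses two patterns
    that differ only at coordinate \<open>k\<close>.\<close>
  have "\<exists>a\<in>A. (\<forall>i<k. a i = x i) \<and> (\<forall>i. k \<le> i \<and> i < n \<longrightarrow> \<sigma> i * (a i - x i) > 0)"
    if "k \<le> n" "\<And>i. i < n \<Longrightarrow> \<sigma> i \<noteq> 0" for k and \<sigma> :: "nat \<Rightarrow> real"
    using that
  proof (induction k arbitrary: \<sigma>)
    case 0
    then show ?case using meets[of \<sigma>] by auto
  next
    case (Suc k)
    have ne: "(\<sigma>(k := c)) i \<noteq> 0" if "c \<noteq> 0" "i < n" for c i using Suc.prems(2) that by auto
    obtain a where a: "a \<in> A" "\<And>i. i < k \<Longrightarrow> a i = x i"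
        "\<And>i. k \<le> i \<Longrightarrow> i < n \<Longrightarrow> (\<sigma>(k := 1)) i * (a i - x i) > 0"
      using Suc.IH[of "\<sigma>(k := 1)"] Suc.prems(1) ne[of 1] by fastforce
    obtain b where b: "b \<in> A" "\<And>i. i < k \<Longrightarrow> b i = x i"
        "\<And>i. k \<le> i \<Longrightarrow> i < n \<Longrightarrow> (\<sigma>(k := - 1)) i * (b i - x i) > 0"
      using Suc.IH[of "\<sigma>(k := - 1)"] Suc.prems(1) ne[of "- 1"] by fastforce
    define \<alpha> \<beta> where "\<alpha> = a k - x k" and "\<beta> = x k - b k"
    have pos: "\<alpha> > 0" "\<beta> > 0" using a(3)[of k] b(3)[of k] Suc.prems(1) by (auto simp: \<alpha>_def \<beta>_def)
    \<comment> \<open>These weights make the deviations of \<open>a\<close> and \<open>b\<close> at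
      coordinate \<open>k\<close> cancel; later coordinates keep their common sign.\<close>
    define p q where "p = \<beta> / (\<alpha> + \<beta>)" and "q = \<alpha> / (\<alpha> + \<beta>)"
    have pq: "p > 0" "q > 0" "p + q = 1" "p * \<alpha> = q * \<beta>"
      using pos by (auto simp: p_def q_def simp flip: add_divide_distrib)
    define c where "c = p *\<^sub>R a + q *\<^sub>R b"
    have c: "c i - x i = p * (a i - x i) + q * (b i - x i)" for i
    proof -
      have "x i = (p + q) * x i" using pq by simp
      then show ?thesis by (simp add: c_def algebra_simps)
    qed
    show ?case
    proof (intro bexI conjI allI impI)
      show "c \<in> A" unfolding c_def using A(1) a(1) b(1) pq by (intro convexD) auto
      fix i assume "i < Suc k"
      then consider "i < k" | "i = k" by linarith
      then have "c i - x i = 0"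
      proof cases
        case 2
        then show ?thesis using c[of k] pq(4) by (simp add: \<alpha>_def \<beta>_def algebra_simps)
      qed (simp add: c a b)
      then show "c i = x i" by simp
    next
      fix i assume "Suc k \<le> i \<and> i < n"
      then have "\<sigma> i * (a i - x i) > 0" "\<sigma> i * (b i - x i) > 0"
        using a(3)[of i] b(3)[of i] by auto
      then have "p * (\<sigma> i * (a i - x i)) + q * (\<sigma> i * (b i - x i)) > 0"
        using pq(1,2) by (intro add_pos_pos mult_pos_pos[of p] mult_pos_pos[of q])
      then show "\<sigma> i * (c i - x i) > 0" by (simp add: c algebra_simps)
    qed
  qed
  from this[of n "\<lambda>_. 1"] obtain a where a: "a \<in> A" "\<And>i. i < n \<Longrightarrow> a i = x i" by auto
  have "a i = x i" for i
    using a A(2) x by (cases "i < n") (auto simp: Rn_def)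
  then have "a = x" by (rule ext)
  then show ?thesis using a(1) by simp
qed

text \<open>The hypothesis concerns the closure of the set \<open>A\<close> where \<open>f\<close>
  is nonzero. Concavity makes \<open>A\<close> convex, and a convex set in finite dimension contains
  the interior of its closure. This is seen here by finding points of \<open>A\<close> in every open
  orthant with apex \<open>x\<close>.\<close>

lemma support_contains_cube:
  assumes f: "\<And>x. x \<in> Rn n \<Longrightarrow> 0 \<le> f x" "root_concave n (real s) f"
    and int: "0 \<in> (top_of_set (Rn n)) interior_of (support_Rn n f)"
  shows "\<exists>\<delta>>0. \<forall>x\<in>Rn n. (\<forall>i<n. \<bar>x i\<bar> < \<delta>) \<longrightarrow> f x > 0"
proof -
  define A where "A = {x \<in> Rn n. f x \<noteq> 0}"
  have Apos: "f x > 0" if "x \<in> A" for x using f(1)[of x] that by (auto simp: A_def less_le)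
  have convA: "convex A"
  proof (rule convexI)
    fix x y :: "nat \<Rightarrow> real" and u v :: real
    assume xy: "x \<in> A" "y \<in> A" "0 \<le> u" "0 \<le> v" "u + v = 1"
    then have u: "u = 1 - v" by simp
    have R: "x \<in> Rn n" "y \<in> Rn n" using xy by (auto simp: A_def)
    have "0 < (1 - v) * f x powr (1 / s) + v * f y powr (1 / s)"
      using xy Apos[of x] Apos[of y]
      by (cases "v = 0") (auto intro!: add_nonneg_pos)
    then have "0 < ((1 - v) * f x powr (1 / s) + v * f y powr (1 / s)) powr s" by simp
    also have "\<dots> \<le> f (u *\<^sub>R x + v *\<^sub>R y)"
      unfolding u by (rule root_concaveD[OF f(2) R Apos Apos]) (use xy in auto)
    finally show "u *\<^sub>R x + v *\<^sub>R y \<in> A" using R by (simp add: A_def)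
  qed
  obtain U where U: "open U" "0 \<in> U" "U \<inter> Rn n \<subseteq> closure A"
    using int unfolding interior_of_def support_Rn_def A_def by (auto simp: openin_open)
  obtain X where X: "0 \<in> (\<Pi>\<^sub>E i\<in>UNIV. X i)" "\<And>i. open (X i)" "(\<Pi>\<^sub>E i\<in>UNIV. X i) \<subseteq> U"
    using product_topology_open_contains_basis[of "\<lambda>_. euclidean" UNIV U 0] U
    by (auto simp: open_fun_def)
  have "\<exists>e>0. \<forall>y. \<bar>y\<bar> < e \<longrightarrow> y \<in> X i" for i
  proof -
    have "0 \<in> X i" using X(1) by (auto simp: PiE_iff)
    then obtain e where "e > 0" "ball 0 e \<subseteq> X i" using X(2) open_contains_ball by blast
    then show ?thesis by (intro exI[of _ e]) (auto simp: subset_eq)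
  qed
  then obtain e where e: "\<And>i. e i > 0" "\<And>i y. \<bar>y\<bar> < e i \<Longrightarrow> y \<in> X i" by metis
  \<comment> \<open>Points of \<open>Rn n\<close> vanish from index \<open>n\<close> on, so finitely
    many radii matter. The extra 1 keeps the set nonempty for \<open>n = 0\<close>.\<close>
  define \<delta> where "\<delta> = Min (insert 1 (e ` {..<n}))"
  have \<delta>: "\<delta> > 0" "\<And>i. i < n \<Longrightarrow> \<delta> \<le> e i" using e(1) by (auto simp: \<delta>_def)
  have cube: "y \<in> closure A" if "y \<in> Rn n" "\<And>i. i < n \<Longrightarrow> \<bar>y i\<bar> < \<delta>" for y
  proof -
    have "y i \<in> X i" for i
    proof (cases "i < n")
      case True
      then show ?thesis using e(2)[of "y i" i] \<delta>(2)[of i] that(2)[of i] by linarith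
    next
      case False
      then show ?thesis using e(2)[of 0 i] e(1)[of i] that(1) by (auto simp: Rn_def)
    qed
    then show ?thesis using X(3) U(3) that(1) by (auto simp: PiE_iff subset_eq)
  qed
  show ?thesis
  proof (intro exI[of _ \<delta>] conjI \<delta>(1) ballI impI)
    fix x assume x: "x \<in> Rn n" and "\<forall>i<n. \<bar>x i\<bar> < \<delta>"
    then have lt: "\<bar>x i\<bar> < \<delta>" if "i < n" for i using that by blast
    have "x \<in> A"
    proof (rule convex_meets_orthants[OF convA _ x])
      fix \<sigma> :: "nat \<Rightarrow> real" assume \<sigma>: "\<And>i. i < n \<Longrightarrow> \<sigma> i \<noteq> 0"
      \<comment> \<open>Each coordinate moves in the direction of its sign by half of its distance
        to the boundary of the cube, so \<open>y\<close> stays in the cube.\<close>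
      define y where "y = (\<lambda>i. if i < n then x i + sgn (\<sigma> i) * ((\<delta> - \<bar>x i\<bar>) / 2) else 0)"
      have yc: "y \<in> closure A"
      proof (rule cube)
        fix i assume i: "i < n"
        have "\<bar>sgn (\<sigma> i) * ((\<delta> - \<bar>x i\<bar>) / 2)\<bar> \<le> (\<delta> - \<bar>x i\<bar>) / 2"
          using lt[OF i] by (simp add: abs_mult sgn_if)
        then show "\<bar>y i\<bar> < \<delta>" using i lt[OF i] by (simp add: y_def)
      qed (simp add: y_def Rn_def)
      \<comment> \<open>As a finite intersection the orthant is open in the product topology; since
        it contains \<open>y\<close> from the closure of \<open>A\<close>, it meets
        \<open>A\<close>.\<close>
      define V where "V = (\<Inter>i\<in>{..<n}. {z :: nat \<Rightarrow> real. 0 < \<sigma> i * (z i - x i)})"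
      have "open V" unfolding V_def
        by (intro open_INT ballI open_Collect_less continuous_intros
            continuous_on_subset[OF continuous_on_product_coordinates]) auto
      moreover have "y \<in> V"
      proof -
        have "\<sigma> i * (y i - x i) > 0" if "i < n" for i
        proof -
          have "\<sigma> i * (y i - x i) = \<bar>\<sigma> i\<bar> * ((\<delta> - \<bar>x i\<bar>) / 2)"
            using that by (simp add: y_def abs_sgn)
          also have "\<dots> > 0" using \<sigma>[OF that] lt[OF that] by (intro mult_pos_pos) auto
          finally show ?thesis .
        qed
        then show ?thesis by (simp add: V_def)
      qed
      ultimately have "V \<inter> A \<noteq> {}" using yc open_Int_closure_eq_empty[of V A] by blast
      then show "\<exists>a\<in>A. \<forall>i<n. \<sigma> i * (a i - x i) > 0" by (auto simp: V_def)
    qed (auto simp: A_def)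
    then show "f x > 0" by (rule Apos)
  qed
qed

text \<open>A vanishing integral would put the cube on which \<open>f\<close> is positive inside a
  null set, yet its measure is \<open>(2 \<delta>)^n > 0\<close>. Positivity permits the
  cancellation when both functions coincide.\<close>

lemma admissible_integral_pos:
  assumes f: "admissible n (real s) f"
  shows "(\<integral>\<^sup>+x. ennreal (f x) \<partial>lebesgue_Rn n) \<noteq> 0"
proof
  assume 0: "(\<integral>\<^sup>+x. ennreal (f x) \<partial>lebesgue_Rn n) = 0"
  have nn: "\<And>x. x \<in> Rn n \<Longrightarrow> 0 \<le> f x" and rc: "root_concave n (real s) f"
    and int: "0 \<in> (top_of_set (Rn n)) interior_of (support_Rn n f)"
    using f by (auto simp: admissible_def)
  obtain \<delta> where \<delta>: "\<delta> > 0" "\<forall>x\<in>Rn n. (\<forall>i<n. \<bar>x i\<bar> < \<delta>) \<longrightarrow> f x > 0"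
    using support_contains_cube[OF nn rc int] by blast
  have "f \<in> borel_measurable (lebesgue_Rn n)"
    using f unfolding admissible_def by (auto dest: borel_measurable_integrable)
  then have "AE x in lborel_Rn n. ennreal (f x) = 0"
    using 0 unfolding lebesgue_Rn_eq
    by (subst (asm) nn_integral_0_iff_AE) (simp_all add: AE_completion_iff)
  then obtain N where N: "{x \<in> space (lborel_Rn n). \<not> ennreal (f x) = 0} \<subseteq> N"
      "emeasure (lborel_Rn n) N = 0" "N \<in> sets (lborel_Rn n)"
    by (rule AE_E)
  interpret product_sigma_finite "\<lambda>_::nat. lborel :: real measure"
    by standard
  let ?P = "\<Pi>\<^sub>M i\<in>{..<n}. (lborel :: real measure)"
  let ?T = "\<lambda>c i. if i < n then c i else (0::real)"
  have "0 < ennreal ((2 * \<delta>) ^ n)" using \<delta>(1) by simp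
  also have "\<dots> = (\<Prod>i<n. ennreal (2 * \<delta>))" using \<delta>(1) by (simp add: ennreal_power)
  also have "\<dots> = emeasure ?P (\<Pi>\<^sub>E i\<in>{..<n}. {-\<delta><..<\<delta>})"
    using \<delta>(1) by (subst emeasure_PiM) auto
  also have "\<dots> \<le> emeasure ?P (?T -` N \<inter> space ?P)"
  proof (rule emeasure_mono)
    show "(\<Pi>\<^sub>E i\<in>{..<n}. {-\<delta><..<\<delta>}) \<subseteq> ?T -` N \<inter> space ?P"
    proof
      fix c assume c: "c \<in> (\<Pi>\<^sub>E i\<in>{..<n}. {-\<delta><..<\<delta>})"
      have T: "?T c \<in> Rn n" by (simp add: Rn_def)
      have "\<bar>c i\<bar> < \<delta>" if "i < n" for i
        using PiE_mem[OF c, of i] that by auto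
      then have "f (?T c) > 0" using \<delta>(2) T by simp
      then have "?T c \<in> N" using N(1) T by (auto simp: ennreal_eq_0_iff)
      then show "c \<in> ?T -` N \<inter> space ?P" using c by (auto simp: space_PiM PiE_iff)
    qed
    show "?T -` N \<inter> space ?P \<in> sets ?P"
      using N(3) measurable_lebesgue_Rn_map[of n] by (intro measurable_sets) simp_all
  qed
  also have "\<dots> = emeasure (lborel_Rn n) N"
    unfolding lborel_Rn_def using N(3) measurable_lebesgue_Rn_map[of n]
    by (intro emeasure_distr[symmetric]) simp_all
  finally show False using N(2) by simp
qed

section \<open>The case of equal functions\<close>

lemma Delta_self_uminus: "Delta n s f f (- x) = Delta n s f f x"
proof -
  have M: "M_root s a b = M_root s b a" for a b by (simp add: M_root_def mult.commute add.commute)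
  have "Delta n s f f x \<le> Delta n s f f (- x)" for x
    unfolding Delta_def
  proof (rule SUP_least, clarify)
    fix x1 x2 assume "x1 \<in> Rn n" "x2 \<in> Rn n"
    then show "ennreal (M_root s (f x1) (f x2)) \<le> (SUP (y1, y2) \<in> {(y1, y2). y1 \<in> Rn n \<and> y2 \<in> Rn n \<and>
        - (x1 - x2) = y1 - y2}. ennreal (M_root s (f y1) (f y2)))"
      \<comment> \<open>Exchanging the two points negates their difference, and
        \<open>M_root\<close> is symmetric.\<close>
      by (intro SUP_upper2[of "(x2, x1)"]) (auto simp: M[of "f x1"])
  qed
  from this[of x] this[of "- x"] show ?thesis by simp
qed

text \<open>The general inequality produces \<open>f (y - x)\<close>. It is applied to the reflected
  density, which is again radially decreasing; undoing the reflection turns this into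
  \<open>f (x + y)\<close> and leaves \<open>Delta n s f f\<close> fixed because it is even.\<close>

proposition difference_inequality_self:
  assumes m: "1 \<le> m" "m \<le> n" "1 \<le> s"
    and \<phi>: "\<phi> \<in> borel_measurable (borel_Rn n)" "radially_decreasing n \<phi>"
    and H: "subspace H" "H \<subseteq> Rn n" "dim H = m"
    and f: "admissible n s f"
  shows "subspace_integral n H \<phi> (Delta n s f f)
       \<le> ennreal (Const (2 * exp 1) n m s) *
         (SUP y\<in>Rn n. subspace_integral n H \<phi> (\<lambda>x. ennreal (f (x + y))))"
proof -
  let ?I = "\<integral>\<^sup>+x. ennreal (f x) \<partial>lebesgue_Rn n"
  let ?\<psi> = "\<lambda>x. \<phi> (- x)"
  have \<psi>: "?\<psi> \<in> borel_measurable (borel_Rn n)" "radially_decreasing n ?\<psi>"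
    using measurable_compose[OF measurable_affine_borel_Rn[of 0 n "-1"] \<phi>(1)] \<phi>(2)
    by (auto simp: radially_decreasing_def simp flip: scaleR_minus_right)
  have refl: "subspace_integral n H ?\<psi> F = subspace_integral n H \<phi> (\<lambda>x. F (- x))" for F
    using nn_integral_lborel_subspace_uminus[OF H(1,2), of "\<lambda>x. F x * ennreal (?\<psi> x)"]
    by (simp add: subspace_integral_eq)
  \<comment> \<open>Cancelling \<open>?I\<close> in \<open>ennreal\<close> requires it to be finite
    and nonzero.\<close>
  have "?I < \<infinity>"
  proof (rule order.strict_trans1)
    show "?I \<le> (\<integral>\<^sup>+x. ennreal (norm (f x)) \<partial>lebesgue_Rn n)"
      by (intro nn_integral_mono ennreal_leI) simp
    show "\<dots> < \<infinity>"
      using f by (simp add: admissible_def integrable_iff_bounded)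
  qed
  moreover have "?I \<noteq> 0" by (rule admissible_integral_pos[OF f])
  moreover have "?I * subspace_integral n H \<phi> (Delta n s f f)
      \<le> ?I * (ennreal (Const (2 * exp 1) n m s) *
        (SUP y\<in>Rn n. subspace_integral n H \<phi> (\<lambda>x. ennreal (f (x + y)))))"
    using difference_inequality[OF m \<psi> H f f]
    by (simp add: refl Delta_self_uminus add.commute mult_ac)
  ultimately show ?thesis
    by (subst (asm) ennreal_mult_le_mult_iff) auto
qed

theorem theorem15:
  shows "\<exists>C>0. \<forall>(n::nat) (m::nat) (s::nat) (\<phi> :: (nat \<Rightarrow> real) \<Rightarrow> real) (H :: (nat \<Rightarrow> real) set).
    1 \<le> m \<and> m \<le> n \<and> 1 \<le> s \<and>
    \<phi> \<in> borel_measurable (borel_Rn n) \<and> (\<forall>x\<in>Rn n. 0 \<le> \<phi> x) \<and> radially_decreasing n \<phi> \<and>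
    subspace H \<and> H \<subseteq> Rn n \<and> dim H = m \<longrightarrow>
    (\<forall>f g. admissible n s f \<and> admissible n s g \<longrightarrow>
       (\<integral>\<^sup>+x. ennreal (min (f x) (g x)) \<partial>lebesgue_Rn n) * subspace_integral n H \<phi> (Delta n s f g)
       \<le> ennreal (Const C n m s) * (\<integral>\<^sup>+x. ennreal (f x) \<partial>lebesgue_Rn n) *
         (SUP y\<in>Rn n. subspace_integral n H \<phi> (\<lambda>x. ennreal (g (y - x))))) \<and>
    (\<forall>f. admissible n s f \<longrightarrow>
       subspace_integral n H \<phi> (Delta n s f f)
       \<le> ennreal (Const C n m s) *
         (SUP y\<in>Rn n. subspace_integral n H \<phi> (\<lambda>x. ennreal (f (x + y)))))"
proof (intro exI[of _ "2 * exp 1"] conjI allI impI; (elim conjE)?)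
  show "0 < 2 * exp (1::real)" by simp
qed (rule difference_inequality difference_inequality_self; assumption)+

end
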